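(* Let $\Omega\subset\mathbb{R}^2$ be a convex polygon with vertices $\mathbf{v}_1,\dots,\mathbf{v}_n$, let $\{\lambda_i\}_{i=1}^n$ be barycentric coordinates on $\Omega$, let $\mu_{ab}=\lambda_a\lambda_b$ for $ab\in I$, let $c^{ij}_{ab}\in\mathbb{R}$ ($ij\in V\cup E$, $ab\in I$) be coefficients, and let $\xi_{ij}:=\sum_{ab\in I}c^{ij}_{ab}\mu_{ab}$ for $ij\in V\cup E$. Consider the following constraints on the coefficients. (Qc1) $\sum_{ii\in V}c^{ii}_{aa}+\sum_{i(i+1)\in E}2c^{i(i+1)}_{aa}=1$ for all $aa\in V$, and $\sum_{ii\in V}c^{ii}_{ab}+\sum_{i(i+1)\in E}2c^{i(i+1)}_{ab}=2$ for all $ab\in E\cup D$. (Qc2) $\sum_{ii\in V}c^{ii}_{aa}\mathbf{v}_{ii}+\sum_{i(i+1)\in E}2c^{i(i+1)}_{aa}\mathbf{v}_{i(i+1)}=\mathbf{v}_{aa}$ for all $aa\in V$, and $\sum_{ii\in V}c^{ii}_{ab}\mathbf{v}_{ii}+\sum_{i(i+1)\in E}2c^{i(i+1)}_{ab}\mathbf{v}_{i(i+1)}=2\mathbf{v}_{ab}$ for all $ab\in E\cup D$. (Qc3) $\sum_{ii\in V}c^{ii}_{aa}\mathbf{v}_i\mathbf{v}_i^T+\sum_{i(i+1)\in E}c^{i(i+1)}_{aa}(\mathbf{v}_i\mathbf{v}_{i+1}^T+\mathbf{v}_{i+1}\mathbf{v}_i^T)=\mathbf{v}_a\mathbf{v}_a^T$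 for all $aa\in V$, and $\sum_{ii\in V}c^{ii}_{ab}\mathbf{v}_i\mathbf{v}_i^T+\sum_{i(i+1)\in E}c^{i(i+1)}_{ab}(\mathbf{v}_i\mathbf{v}_{i+1}^T+\mathbf{v}_{i+1}\mathbf{v}_i^T)=\mathbf{v}_a\mathbf{v}_b^T+\mathbf{v}_b\mathbf{v}_a^T$ for all $ab\in E\cup D$. Consider also the following identities, for all $\mathbf{x}\in\Omega$ (functions evaluated at $\mathbf{x}$). (Qx1) $\sum_{ii\in V}\xi_{ii}+\sum_{i(i+1)\in E}2\xi_{i(i+1)}=1$. (Qx2) $\sum_{ii\in V}\mathbf{v}_{ii}\xi_{ii}+\sum_{i(i+1)\in E}2\mathbf{v}_{i(i+1)}\xi_{i(i+1)}=\mathbf{x}$. (Qx3) $\sum_{ii\in V}\mathbf{v}_i\mathbf{v}_i^T\xi_{ii}+\sum_{i(i+1)\in E}(\mathbf{v}_i\mathbf{v}_{i+1}^T+\mathbf{v}_{i+1}\mathbf{v}_i^T)\xi_{i(i+1)}=\mathbf{x}\mathbf{x}^T$. Then (Qc1) implies (Qx1), (Qc2) implies (Qx2), and (Qc3) implies (Qx3).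
   Context: Vertices of a polygon are ordered counter-clockwise and viewed as column vectors in $\mathbb{R}^2$; vertex indices are taken modulo $n$. Barycentric coordinates on $\Omega$ are functions $\lambda_i:\Omega\to\mathbb{R}$, $i=1,\dots,n$, with $\lambda_i\ge 0$ on $\Omega$ and $L=\sum_{i=1}^n L(\mathbf{v}_i)\lambda_i$ on $\Omega$ for every linear (i.e. affine, degree at most one) function $L:\Omega\to\mathbb{R}$. Index sets: $I=\{\{a,b\}: a,b\in\{1,\dots,n\}\}$ is the set of unordered, possibly non-distinct pairs; $V=\{\{a,a\}\}$, $E=\{\{a,a+1\}: a=1,\dots,n\}$, $D=I\setminus(V\cup E)$. One writes $ab$ for $\{a,b\}$, and $\mathbf{v}_{ab}:=(\mathbf{v}_a+\mathbf{v}_b)/2$ (so $\mathbf{v}_{aa}=\mathbf{v}_a$). *)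

theory Defs
  imports "HOL-Analysis.Analysis" "HOL-Library.Uprod"
begin

(* Vertices are v 1, ..., v n; the index after n is 1. *)
definition nxt :: "nat \<Rightarrow> nat \<Rightarrow> nat" where
  "nxt n i = i mod n + 1"

(* The vertices of a polytope are its extreme points.  The last clause says that they
   are listed counter-clockwise: every vertex other than the two endpoints lies strictly
   to the left of the directed edge from v i to v (i+1).  The matrix has the two
   difference vectors as rows. *)
definition convex_polygon :: "nat \<Rightarrow> (nat \<Rightarrow> real^2) \<Rightarrow> (real^2) set \<Rightarrow> bool" where
  "convex_polygon n v \<Omega> \<longleftrightarrow>
     n \<ge> 3 \<and> polytope \<Omega> \<and> bij_betw v {1..n} {x. x extreme_point_of \<Omega>} \<and>
     (\<forall>i\<in>{1..n}. \<forall>k\<in>{1..n} - {i, nxt n i}.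
        det (vector [v (nxt n i) - v i, v k - v i] :: real^2^2) > 0)"

(* Polynomial functions of degree at most one. *)
definition affine_function :: "(real^2 \<Rightarrow> real) \<Rightarrow> bool" where
  "affine_function L \<longleftrightarrow> (\<exists>M d. linear M \<and> L = (\<lambda>x. M x + d))"

(* The values of the functions outside \<Omega> are irrelevant. *)
definition barycentric_coordinates ::
  "nat \<Rightarrow> (nat \<Rightarrow> real^2) \<Rightarrow> (real^2) set \<Rightarrow> (nat \<Rightarrow> real^2 \<Rightarrow> real) \<Rightarrow> bool" where
  "barycentric_coordinates n v \<Omega> lam \<longleftrightarrow>
     (\<forall>i\<in>{1..n}. \<forall>x\<in>\<Omega>. lam i x \<ge> 0) \<and>
     (\<forall>L. affine_function L \<longrightarrow> (\<forall>x\<in>\<Omega>. L x = (\<Sum>i=1..n. L (v i) * lam i x)))"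

(* An unordered, possibly non-distinct pair ab is Upair a b; in particular
   Upair a b = Upair b a. *)
definition index_I :: "nat \<Rightarrow> nat uprod set" where
  "index_I n = {Upair a b | a b. a \<in> {1..n} \<and> b \<in> {1..n}}"

definition index_V :: "nat \<Rightarrow> nat uprod set" where
  "index_V n = {Upair a a | a. a \<in> {1..n}}"

definition index_E :: "nat \<Rightarrow> nat uprod set" where
  "index_E n = {Upair a (nxt n a) | a. a \<in> {1..n}}"

definition index_D :: "nat \<Rightarrow> nat uprod set" where
  "index_D n = index_I n - (index_V n \<union> index_E n)"

(* Sums over V and E are written below as sums over i = 1..n, so that the summands can
   refer to i and i+1.  The next two facts show that no pair is counted twice. *)
lemma bij_betw_index_V: "bij_betw (\<lambda>i. Upair i i) {1..n} (index_V n)"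
  by (auto simp: bij_betw_def inj_on_def index_V_def)

lemma bij_betw_index_E:
  assumes "n \<ge> 3"
  shows "bij_betw (\<lambda>i. Upair i (nxt n i)) {1..n} (index_E n)"
proof -
  have nxt: "nxt n i = (if i = n then 1 else i + 1)" if "i \<in> {1..n}" for i
    using that by (auto simp: nxt_def)
  have "inj_on (\<lambda>i. Upair i (nxt n i)) {1..n}"
    using assms by (intro inj_onI) (auto simp: nxt split: if_splits)
  then show ?thesis
    by (auto simp: bij_betw_def index_E_def)
qed

lift_definition node :: "(nat \<Rightarrow> real^2) \<Rightarrow> nat uprod \<Rightarrow> real^2"
  is "\<lambda>v (a, b). (1 / 2) *\<^sub>R (v a + v b)"
  by (auto simp: add.commute)

lift_definition mu :: "(nat \<Rightarrow> real^2 \<Rightarrow> real) \<Rightarrow> nat uprod \<Rightarrow> real^2 \<Rightarrow> real"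
  is "\<lambda>lam (a, b) x. lam a x * lam b x"
  by (auto simp: mult.commute)

(* c ij ab is the coefficient with upper index ij and lower index ab; only the values
   with ij in V \<union> E and ab in I are used. *)
definition xi ::
  "nat \<Rightarrow> (nat uprod \<Rightarrow> nat uprod \<Rightarrow> real) \<Rightarrow> (nat \<Rightarrow> real^2 \<Rightarrow> real)
     \<Rightarrow> nat uprod \<Rightarrow> real^2 \<Rightarrow> real" where
  "xi n c lam ij x = (\<Sum>ab\<in>index_I n. c ij ab * mu lam ab x)"

definition outer :: "real^2 \<Rightarrow> real^2 \<Rightarrow> real^2^2" where
  "outer u w = (columnvector u :: real^1^2) ** transpose (columnvector w :: real^1^2)"

definition Qc1 :: "nat \<Rightarrow> (nat uprod \<Rightarrow> nat uprod \<Rightarrow> real) \<Rightarrow> bool" where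
  "Qc1 n c \<longleftrightarrow>
     (\<forall>aa\<in>index_V n.
        (\<Sum>i=1..n. c (Upair i i) aa) + (\<Sum>i=1..n. 2 * c (Upair i (nxt n i)) aa) = 1) \<and>
     (\<forall>ab\<in>index_E n \<union> index_D n.
        (\<Sum>i=1..n. c (Upair i i) ab) + (\<Sum>i=1..n. 2 * c (Upair i (nxt n i)) ab) = 2)"

definition Qc2 ::
  "nat \<Rightarrow> (nat \<Rightarrow> real^2) \<Rightarrow> (nat uprod \<Rightarrow> nat uprod \<Rightarrow> real) \<Rightarrow> bool" where
  "Qc2 n v c \<longleftrightarrow>
     (\<forall>aa\<in>index_V n.
        (\<Sum>i=1..n. c (Upair i i) aa *\<^sub>R node v (Upair i i)) +
        (\<Sum>i=1..n. (2 * c (Upair i (nxt n i)) aa) *\<^sub>R node v (Upair i (nxt n i)))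
        = node v aa) \<and>
     (\<forall>ab\<in>index_E n \<union> index_D n.
        (\<Sum>i=1..n. c (Upair i i) ab *\<^sub>R node v (Upair i i)) +
        (\<Sum>i=1..n. (2 * c (Upair i (nxt n i)) ab) *\<^sub>R node v (Upair i (nxt n i)))
        = 2 *\<^sub>R node v ab)"

definition Qc3 ::
  "nat \<Rightarrow> (nat \<Rightarrow> real^2) \<Rightarrow> (nat uprod \<Rightarrow> nat uprod \<Rightarrow> real) \<Rightarrow> bool" where
  "Qc3 n v c \<longleftrightarrow>
     (\<forall>a. Upair a a \<in> index_V n \<longrightarrow>
        (\<Sum>i=1..n. c (Upair i i) (Upair a a) *\<^sub>R outer (v i) (v i)) +
        (\<Sum>i=1..n. c (Upair i (nxt n i)) (Upair a a) *\<^sub>R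
           (outer (v i) (v (nxt n i)) + outer (v (nxt n i)) (v i)))
        = outer (v a) (v a)) \<and>
     (\<forall>a b. Upair a b \<in> index_E n \<union> index_D n \<longrightarrow>
        (\<Sum>i=1..n. c (Upair i i) (Upair a b) *\<^sub>R outer (v i) (v i)) +
        (\<Sum>i=1..n. c (Upair i (nxt n i)) (Upair a b) *\<^sub>R
           (outer (v i) (v (nxt n i)) + outer (v (nxt n i)) (v i)))
        = outer (v a) (v b) + outer (v b) (v a))"

definition Qx1 :: "nat \<Rightarrow> (real^2) set \<Rightarrow> (nat uprod \<Rightarrow> real^2 \<Rightarrow> real) \<Rightarrow> bool" where
  "Qx1 n \<Omega> \<xi> \<longleftrightarrow>
     (\<forall>x\<in>\<Omega>. (\<Sum>i=1..n. \<xi> (Upair i i) x) + (\<Sum>i=1..n. 2 * \<xi> (Upair i (nxt n i)) x) = 1)"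

definition Qx2 ::
  "nat \<Rightarrow> (nat \<Rightarrow> real^2) \<Rightarrow> (real^2) set \<Rightarrow> (nat uprod \<Rightarrow> real^2 \<Rightarrow> real) \<Rightarrow> bool" where
  "Qx2 n v \<Omega> \<xi> \<longleftrightarrow>
     (\<forall>x\<in>\<Omega>.
        (\<Sum>i=1..n. \<xi> (Upair i i) x *\<^sub>R node v (Upair i i)) +
        (\<Sum>i=1..n. (2 * \<xi> (Upair i (nxt n i)) x) *\<^sub>R node v (Upair i (nxt n i)))
        = x)"

definition Qx3 ::
  "nat \<Rightarrow> (nat \<Rightarrow> real^2) \<Rightarrow> (real^2) set \<Rightarrow> (nat uprod \<Rightarrow> real^2 \<Rightarrow> real) \<Rightarrow> bool" where
  "Qx3 n v \<Omega> \<xi> \<longleftrightarrow>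
     (\<forall>x\<in>\<Omega>.
        (\<Sum>i=1..n. \<xi> (Upair i i) x *\<^sub>R outer (v i) (v i)) +
        (\<Sum>i=1..n. \<xi> (Upair i (nxt n i)) x *\<^sub>R
           (outer (v i) (v (nxt n i)) + outer (v (nxt n i)) (v i)))
        = outer x x)"

end

theory Submission
  imports Defs
begin

text \<open>
  All three implications are instances of one principle.  The left-hand side of each
  pointwise identity is linear in the functions \<open>\<xi>\<close>, hence in the products
  \<open>\<mu>\<^sub>a\<^sub>b = \<lambda>\<^sub>a \<lambda>\<^sub>b\<close>, and the coefficient of \<open>\<mu>\<^sub>a\<^sub>b\<close> in it is exactly the left-hand side of
  the corresponding constraint.  The right-hand sides of the constraint have the form
  \<open>F a a\<close> on the diagonal and \<open>F a b + F b a\<close> off it, with \<open>F a b = 1\<close>,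
  \<open>F a b = v\<^sub>a\<close> and \<open>F a b = v\<^sub>a v\<^sub>b\<^sup>T\<close> respectively.  These are the weights with which
  a sum over ordered pairs collapses to a sum over unordered pairs (lemma
  \<open>sum_unordered_pairs\<close>), so the constraint turns the left-hand side into
  \<open>\<Sum>a. \<Sum>b. \<lambda>\<^sub>a \<lambda>\<^sub>b F a b\<close> (lemma \<open>xi_sum_eq_double_sum\<close>).  This double sum factors, and since
  the coordinates satisfy \<open>\<Sum>a. \<lambda>\<^sub>a = 1\<close> and \<open>\<Sum>a. \<lambda>\<^sub>a v\<^sub>a = x\<close>, it equals
  \<open>1\<close>, \<open>x\<close> and \<open>x x\<^sup>T\<close> respectively.
\<close>

lemma node_Upair: "node v (Upair a b) = (1 / 2) *\<^sub>R (v a + v b)"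
  by transfer simp

lemma mu_Upair: "mu lam (Upair a b) x = lam a x * lam b x"
  by transfer simp

lemma index_I_eq_image: "index_I n = (\<lambda>(a, b). Upair a b) ` ({1..n} \<times> {1..n})"
  by (auto simp: index_I_def image_iff) blast

lemma Upair_diagonal_in_index_V: "a \<in> {1..n} \<Longrightarrow> Upair a a \<in> index_V n"
  by (auto simp: index_V_def)

lemma Upair_offdiagonal_in_index_E_D:
  assumes "a \<in> {1..n}" "b \<in> {1..n}" "a \<noteq> b"
  shows "Upair a b \<in> index_E n \<union> index_D n"
  using assms by (auto simp: index_D_def index_I_def index_V_def)

text \<open>
  The fibre of the map from ordered to unordered pairs over \<open>{a, b}\<close> consists of
  \<open>(a, b)\<close> and \<open>(b, a)\<close>, which coincide precisely on the diagonal; hence the two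
  different conditions on \<open>G\<close>.
\<close>

lemma sum_unordered_pairs:
  fixes F :: "nat \<Rightarrow> nat \<Rightarrow> 'a::comm_monoid_add"
  assumes diag: "\<And>a. a \<in> {1..n} \<Longrightarrow> G (Upair a a) = F a a"
    and offdiag: "\<And>a b. a \<in> {1..n} \<Longrightarrow> b \<in> {1..n} \<Longrightarrow> a \<noteq> b \<Longrightarrow>
                    G (Upair a b) = F a b + F b a"
  shows "(\<Sum>ab\<in>index_I n. G ab) = (\<Sum>a=1..n. \<Sum>b=1..n. F a b)"
proof -
  let ?P = "{1..n} \<times> {1..n}"
  have fibre: "(\<Sum>p\<in>{p \<in> ?P. (case p of (a, b) \<Rightarrow> Upair a b) = ab}. case p of (a, b) \<Rightarrow> F a b) = G ab"
    if ab_in: "ab \<in> index_I n" for ab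
  proof -
    obtain a b where ab: "ab = Upair a b" and mem: "a \<in> {1..n}" "b \<in> {1..n}"
      using ab_in unfolding index_I_def by blast
    have "{p \<in> ?P. (case p of (a, b) \<Rightarrow> Upair a b) = ab} = {(a, b), (b, a)}"
      using mem by (auto simp: ab)
    then show ?thesis
      using mem diag offdiag by (cases "a = b") (simp_all add: ab)
  qed
  have "(\<Sum>a=1..n. \<Sum>b=1..n. F a b) = (\<Sum>p\<in>?P. case p of (a, b) \<Rightarrow> F a b)"
    by (rule sum.cartesian_product)
  also have "\<dots> = (\<Sum>ab\<in>index_I n.
      \<Sum>p\<in>{p \<in> ?P. (case p of (a, b) \<Rightarrow> Upair a b) = ab}. case p of (a, b) \<Rightarrow> F a b)"
    unfolding index_I_eq_image by (rule sum.image_gen) simp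
  also have "\<dots> = (\<Sum>ab\<in>index_I n. G ab)"
    by (rule sum.cong[OF refl fibre])
  finally show ?thesis by simp
qed

text \<open>
  The common core of the three implications.  The vectors \<open>p i\<close> and \<open>q i\<close> stand for
  the weights attached to vertices and edges; exchanging the order of summation
  exhibits the constraint as the coefficient of each product of coordinates.
\<close>

lemma xi_sum_eq_double_sum:
  fixes p q :: "nat \<Rightarrow> 'a::real_vector"
  assumes diag: "\<And>a. a \<in> {1..n} \<Longrightarrow>
      (\<Sum>i=1..n. c (Upair i i) (Upair a a) *\<^sub>R p i) +
      (\<Sum>i=1..n. c (Upair i (nxt n i)) (Upair a a) *\<^sub>R q i) = F a a"
    and offdiag: "\<And>a b. a \<in> {1..n} \<Longrightarrow> b \<in> {1..n} \<Longrightarrow> a \<noteq> b \<Longrightarrow>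
      (\<Sum>i=1..n. c (Upair i i) (Upair a b) *\<^sub>R p i) +
      (\<Sum>i=1..n. c (Upair i (nxt n i)) (Upair a b) *\<^sub>R q i) = F a b + F b a"
  shows "(\<Sum>i=1..n. xi n c lam (Upair i i) x *\<^sub>R p i) +
         (\<Sum>i=1..n. xi n c lam (Upair i (nxt n i)) x *\<^sub>R q i)
         = (\<Sum>a=1..n. \<Sum>b=1..n. (lam a x * lam b x) *\<^sub>R F a b)"
proof -
  have swap: "(\<Sum>i=1..n. xi n c lam (e i) x *\<^sub>R r i) =
      (\<Sum>ab\<in>index_I n. mu lam ab x *\<^sub>R (\<Sum>i=1..n. c (e i) ab *\<^sub>R r i))"
    for e and r :: "nat \<Rightarrow> 'a"
  proof -
    have "(\<Sum>i=1..n. xi n c lam (e i) x *\<^sub>R r i) =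
        (\<Sum>i=1..n. \<Sum>ab\<in>index_I n. mu lam ab x *\<^sub>R c (e i) ab *\<^sub>R r i)"
      by (simp add: xi_def scaleR_sum_left mult.commute)
    also have "\<dots> = (\<Sum>ab\<in>index_I n. \<Sum>i=1..n. mu lam ab x *\<^sub>R c (e i) ab *\<^sub>R r i)"
      by (rule sum.swap)
    finally show ?thesis
      by (simp only: scaleR_sum_right)
  qed
  have "(\<Sum>i=1..n. xi n c lam (Upair i i) x *\<^sub>R p i) +
        (\<Sum>i=1..n. xi n c lam (Upair i (nxt n i)) x *\<^sub>R q i)
      = (\<Sum>ab\<in>index_I n. mu lam ab x *\<^sub>R
          ((\<Sum>i=1..n. c (Upair i i) ab *\<^sub>R p i) + (\<Sum>i=1..n. c (Upair i (nxt n i)) ab *\<^sub>R q i)))"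
    by (simp only: swap sum.distrib scaleR_add_right)
  also have "\<dots> = (\<Sum>a=1..n. \<Sum>b=1..n. (lam a x * lam b x) *\<^sub>R F a b)"
  proof (rule sum_unordered_pairs, goal_cases)
    case (1 a)
    show ?case
      by (simp only: diag[OF 1] mu_Upair)
  next
    case (2 a b)
    show ?case
      by (simp only: offdiag[OF 2] mu_Upair scaleR_add_right mult.commute[of "lam b x"])
  qed
  finally show ?thesis .
qed

lemma barycentric_coordinates_sum_1:
  assumes "barycentric_coordinates n v \<Omega> lam" "x \<in> \<Omega>"
  shows "(\<Sum>i=1..n. lam i x) = 1"
proof -
  have "affine_function (\<lambda>_. 1)"
    unfolding affine_function_def
    by (intro exI[of _ "\<lambda>_. 0"] exI[of _ 1]) (simp add: linear_zero)
  then show ?thesis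
    using assms by (fastforce simp: barycentric_coordinates_def)
qed

lemma barycentric_coordinates_sum_vertices:
  assumes "barycentric_coordinates n v \<Omega> lam" "x \<in> \<Omega>"
  shows "(\<Sum>i=1..n. lam i x *\<^sub>R v i) = x"
proof -
  have "(\<Sum>i=1..n. v i $ k * lam i x) = x $ k" for k
  proof -
    have "affine_function (\<lambda>y. y $ k)"
      unfolding affine_function_def
      by (intro exI[of _ "\<lambda>y. y $ k"] exI[of _ 0])
        (simp add: bounded_linear.linear[OF bounded_linear_vec_nth])
    then show ?thesis
      using assms by (fastforce simp: barycentric_coordinates_def)
  qed
  then show ?thesis
    by (simp add: vec_eq_iff mult.commute)
qed

lemma outer_nth: "outer u w $ i $ j = u $ i * w $ j"
  by (simp add: outer_def columnvector_def transpose_def matrix_matrix_mult_def)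

lemma outer_sum_scaleR:
  "outer (\<Sum>a\<in>A. f a *\<^sub>R u a) (\<Sum>b\<in>B. g b *\<^sub>R w b) =
     (\<Sum>a\<in>A. \<Sum>b\<in>B. (f a * g b) *\<^sub>R outer (u a) (w b))"
  by (simp add: vec_eq_iff outer_nth sum_product algebra_simps)

theorem lemma3p1:
  fixes n :: nat
    and v :: "nat \<Rightarrow> real^2"
    and \<Omega> :: "(real^2) set"
    and lam :: "nat \<Rightarrow> real^2 \<Rightarrow> real"
    and c :: "nat uprod \<Rightarrow> nat uprod \<Rightarrow> real"
  assumes "convex_polygon n v \<Omega>"
    and "barycentric_coordinates n v \<Omega> lam"
  shows "(Qc1 n c \<longrightarrow> Qx1 n \<Omega> (xi n c lam)) \<and>
         (Qc2 n v c \<longrightarrow> Qx2 n v \<Omega> (xi n c lam)) \<and>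
         (Qc3 n v c \<longrightarrow> Qx3 n v \<Omega> (xi n c lam))"
proof (intro conjI impI)
  note V = Upair_diagonal_in_index_V and ED = Upair_offdiagonal_in_index_E_D
  note sum_1 = barycentric_coordinates_sum_1[OF assms(2)]
    and sum_v = barycentric_coordinates_sum_vertices[OF assms(2)]
  show "Qx1 n \<Omega> (xi n c lam)" if Qc1: "Qc1 n c"
    unfolding Qx1_def
  proof
    fix x assume x: "x \<in> \<Omega>"
    have "(\<Sum>i=1..n. xi n c lam (Upair i i) x *\<^sub>R 1) +
          (\<Sum>i=1..n. xi n c lam (Upair i (nxt n i)) x *\<^sub>R 2)
        = (\<Sum>a=1..n. \<Sum>b=1..n. (lam a x * lam b x) *\<^sub>R (1::real))"
    proof (rule xi_sum_eq_double_sum)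
      fix a assume "a \<in> {1..n}"
      from V[OF this] Qc1
      have "(\<Sum>i=1..n. c (Upair i i) (Upair a a)) +
          (\<Sum>i=1..n. 2 * c (Upair i (nxt n i)) (Upair a a)) = 1"
        by (simp only: Qc1_def)
      then show "(\<Sum>i=1..n. c (Upair i i) (Upair a a) *\<^sub>R 1) +
          (\<Sum>i=1..n. c (Upair i (nxt n i)) (Upair a a) *\<^sub>R 2) = (1::real)"
        by (simp add: mult.commute)
    next
      fix a b assume "a \<in> {1..n}" "b \<in> {1..n}" "a \<noteq> b"
      from ED[OF this] Qc1
      have "(\<Sum>i=1..n. c (Upair i i) (Upair a b)) +
          (\<Sum>i=1..n. 2 * c (Upair i (nxt n i)) (Upair a b)) = 2"
        by (simp only: Qc1_def)
      then show "(\<Sum>i=1..n. c (Upair i i) (Upair a b) *\<^sub>R 1) +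
          (\<Sum>i=1..n. c (Upair i (nxt n i)) (Upair a b) *\<^sub>R 2) = 1 + (1::real)"
        by (simp add: mult.commute)
    qed
    also have "\<dots> = (\<Sum>a=1..n. lam a x) * (\<Sum>b=1..n. lam b x)"
      by (simp add: sum_product)
    finally show "(\<Sum>i=1..n. xi n c lam (Upair i i) x) +
        (\<Sum>i=1..n. 2 * xi n c lam (Upair i (nxt n i)) x) = 1"
      by (simp only: sum_1[OF x] real_scaleR_def mult_1_right mult.commute[of 2])
  qed
  show "Qx2 n v \<Omega> (xi n c lam)" if Qc2: "Qc2 n v c"
    unfolding Qx2_def
  proof
    fix x assume x: "x \<in> \<Omega>"
    have "(\<Sum>i=1..n. xi n c lam (Upair i i) x *\<^sub>R node v (Upair i i)) +
          (\<Sum>i=1..n. xi n c lam (Upair i (nxt n i)) x *\<^sub>R (2 *\<^sub>R node v (Upair i (nxt n i))))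
        = (\<Sum>a=1..n. \<Sum>b=1..n. (lam a x * lam b x) *\<^sub>R v a)"
    proof (rule xi_sum_eq_double_sum)
      fix a assume "a \<in> {1..n}"
      from V[OF this] Qc2
      have "(\<Sum>i=1..n. c (Upair i i) (Upair a a) *\<^sub>R node v (Upair i i)) +
          (\<Sum>i=1..n. (2 * c (Upair i (nxt n i)) (Upair a a)) *\<^sub>R node v (Upair i (nxt n i)))
          = node v (Upair a a)"
        by (simp only: Qc2_def)
      moreover have "node v (Upair a a) = v a"
        by (simp add: node_Upair scaleR_2[symmetric])
      ultimately show "(\<Sum>i=1..n. c (Upair i i) (Upair a a) *\<^sub>R node v (Upair i i)) +
          (\<Sum>i=1..n. c (Upair i (nxt n i)) (Upair a a) *\<^sub>R (2 *\<^sub>R node v (Upair i (nxt n i)))) = v a"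
        by (simp add: mult.commute)
    next
      fix a b assume "a \<in> {1..n}" "b \<in> {1..n}" "a \<noteq> b"
      from ED[OF this] Qc2
      have "(\<Sum>i=1..n. c (Upair i i) (Upair a b) *\<^sub>R node v (Upair i i)) +
          (\<Sum>i=1..n. (2 * c (Upair i (nxt n i)) (Upair a b)) *\<^sub>R node v (Upair i (nxt n i)))
          = 2 *\<^sub>R node v (Upair a b)"
        by (simp only: Qc2_def)
      moreover have "2 *\<^sub>R node v (Upair a b) = v a + v b"
        by (simp add: node_Upair)
      ultimately show "(\<Sum>i=1..n. c (Upair i i) (Upair a b) *\<^sub>R node v (Upair i i)) +
          (\<Sum>i=1..n. c (Upair i (nxt n i)) (Upair a b) *\<^sub>R (2 *\<^sub>R node v (Upair i (nxt n i))))
          = v a + v b"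
        by (simp add: mult.commute)
    qed
    also have "\<dots> = (\<Sum>a=1..n. lam a x *\<^sub>R (\<Sum>b=1..n. lam b x) *\<^sub>R v a)"
      by (simp only: scaleR_sum_left scaleR_sum_right scaleR_scaleR)
    finally show "(\<Sum>i=1..n. xi n c lam (Upair i i) x *\<^sub>R node v (Upair i i)) +
        (\<Sum>i=1..n. (2 * xi n c lam (Upair i (nxt n i)) x) *\<^sub>R node v (Upair i (nxt n i))) = x"
      by (simp only: sum_1[OF x] sum_v[OF x] scaleR_one scaleR_scaleR mult.commute[of 2])
  qed
  show "Qx3 n v \<Omega> (xi n c lam)" if Qc3: "Qc3 n v c"
    unfolding Qx3_def
  proof
    fix x assume x: "x \<in> \<Omega>"
    have "(\<Sum>i=1..n. xi n c lam (Upair i i) x *\<^sub>R outer (v i) (v i)) +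
          (\<Sum>i=1..n. xi n c lam (Upair i (nxt n i)) x *\<^sub>R
             (outer (v i) (v (nxt n i)) + outer (v (nxt n i)) (v i)))
        = (\<Sum>a=1..n. \<Sum>b=1..n. (lam a x * lam b x) *\<^sub>R outer (v a) (v b))"
      using Qc3 V ED unfolding Qc3_def by (intro xi_sum_eq_double_sum) blast+
    also have "\<dots> = outer (\<Sum>a=1..n. lam a x *\<^sub>R v a) (\<Sum>b=1..n. lam b x *\<^sub>R v b)"
      by (rule outer_sum_scaleR[symmetric])
    finally show "(\<Sum>i=1..n. xi n c lam (Upair i i) x *\<^sub>R outer (v i) (v i)) +
        (\<Sum>i=1..n. xi n c lam (Upair i (nxt n i)) x *\<^sub>R
           (outer (v i) (v (nxt n i)) + outer (v (nxt n i)) (v i))) = outer x x"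
      by (simp only: sum_v[OF x])
  qed
qed

end
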